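(* Let $\omega=e^{2\pi i/3}$ and define $$A=\begin{pmatrix} 1&-\omega+1&-\omega^2+1&\omega-1&\omega^2-1&\omega-1\\ \omega^2-1&\omega^2&0&-\omega^2+1&0&0\\ \omega^2-1&\omega^2-1&\omega^2&-\omega^2+1&-\omega^2+1&0\\ 0&\omega-1&\omega^2-1&-\omega&-\omega^2+1&-\omega+1\\ -\omega^2+1&-\omega^2+1&0&\omega^2-1&-1&0\\ -\omega^2+1&-\omega^2+1&-\omega^2+1&\omega^2-1&\omega^2-1&-1 \end{pmatrix}$$ and $$B=\begin{pmatrix} 1&-\omega+1&-\omega^2+1&-\omega+1&-\omega^2+1&-\omega+1\\ \omega^2-1&\omega^2&0&\omega^2-1&0&0\\ \omega^2-1&\omega^2-1&\omega^2&\omega^2-1&\omega^2-1&0\\ 0&-\omega+1&-\omega^2+1&-\omega&-\omega^2+1&-\omega+1\\ \omega^2-1&\omega^2-1&0&\omega^2-1&-1&0\\ \omega^2-1&\omega^2-1&\omega^2-1&\omega^2-1&\omega^2-1&-1 \end{pmatrix}.$$ Then $\rho(\sigma_1)=A$ and $\rho(\sigma_2)=B$ define an irreducible representation of $\mathcal{B}_3$ on $\mathbb{C}^6$ which cannot be extended to a representation of $\mathcal{LB}_3$.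
   Context: $\mathcal{B}_3=\langle \sigma_1,\sigma_2 : \sigma_1\sigma_2\sigma_1=\sigma_2\sigma_1\sigma_2\rangle$ is the braid group. The three component loop braid group $\mathcal{LB}_3$ is the group generated by $\sigma_1,\sigma_2,s_1,s_2$ with relations $\sigma_1\sigma_2\sigma_1=\sigma_2\sigma_1\sigma_2$; $s_1s_2s_1=s_2s_1s_2$; $s_1^2=s_2^2=1$; $s_1s_2\sigma_1=\sigma_2s_1s_2$; $\sigma_1\sigma_2s_1=s_2\sigma_1\sigma_2$. An extension of a representation $\rho$ of $\mathcal{B}_3$ on $V$ to $\mathcal{LB}_3$ is a representation of $\mathcal{LB}_3$ on the same space with the same values on $\sigma_1,\sigma_2$. *)

theory Defs
  imports "HOL-Analysis.Analysis" "HOL-Algebra.Group"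
begin

section \<open>Groups given by generators and relations\<close>

text \<open>The letter \<open>(g, True)\<close> stands for the generator \<open>g\<close>, and \<open>(g, False)\<close> for its formal inverse.\<close>

type_synonym 'g word = "('g \<times> bool) list"

inductive word_eq :: "('g word \<times> 'g word) set \<Rightarrow> 'g word \<Rightarrow> 'g word \<Rightarrow> bool"
  for R :: "('g word \<times> 'g word) set"
where
  refl: "word_eq R u u"
| sym: "word_eq R u v \<Longrightarrow> word_eq R v u"
| trans: "word_eq R u v \<Longrightarrow> word_eq R v w \<Longrightarrow> word_eq R u w"
| cancel: "word_eq R (u @ [(g, b), (g, \<not> b)] @ v) (u @ v)"
| relation: "(l, r) \<in> R \<Longrightarrow> word_eq R (u @ l @ v) (u @ r @ v)"

definition word_rel :: "('g word \<times> 'g word) set \<Rightarrow> ('g word \<times> 'g word) set" where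
  "word_rel R = {(u, v). word_eq R u v}"

definition word_class :: "('g word \<times> 'g word) set \<Rightarrow> 'g word \<Rightarrow> 'g word set" where
  "word_class R u = word_rel R `` {u}"

definition presented_group :: "('g word \<times> 'g word) set \<Rightarrow> 'g word set monoid" where
  "presented_group R =
     \<lparr>carrier = UNIV // word_rel R,
      mult = (\<lambda>X Y. \<Union>u\<in>X. \<Union>v\<in>Y. word_class R (u @ v)),
      one = word_class R []\<rparr>"

definition presented_gen :: "('g word \<times> 'g word) set \<Rightarrow> 'g \<Rightarrow> 'g word set" where
  "presented_gen R g = word_class R [(g, True)]"

lemma equiv_word_rel: "equiv UNIV (word_rel R)"
  by (rule equivI)
    (auto simp: word_rel_def refl_on_def intro!: symI transI intro: word_eq.intros(1-3))

lemma word_class_eq_iff: "word_class R u = word_class R v \<longleftrightarrow> word_eq R u v"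
  unfolding word_class_def using eq_equiv_class_iff[OF equiv_word_rel, of u v R]
  by (simp add: word_rel_def)

lemma word_eq_append_left: "word_eq R u v \<Longrightarrow> word_eq R (w @ u) (w @ v)"
proof (induction rule: word_eq.induct)
  case (cancel u g b v)
  show ?case using word_eq.cancel[of R "w @ u" g b v] by simp
next
  case (relation l r u v)
  then show ?case using word_eq.relation[of l r R "w @ u" v] by simp
qed (auto intro: word_eq.intros(1-3))

lemma word_eq_append_right: "word_eq R u v \<Longrightarrow> word_eq R (u @ w) (v @ w)"
proof (induction rule: word_eq.induct)
  case (cancel u g b v)
  show ?case using word_eq.cancel[of R u g b "v @ w"] by simp
next
  case (relation l r u v)
  then show ?case using word_eq.relation[of l r R u "v @ w"] by simp
qed (auto intro: word_eq.intros(1-3))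

lemma word_eq_append:
  "word_eq R u u' \<Longrightarrow> word_eq R v v' \<Longrightarrow> word_eq R (u @ v) (u' @ v')"
  by (meson word_eq.trans word_eq_append_left word_eq_append_right)

lemma presented_mult:
  "word_class R u \<otimes>\<^bsub>presented_group R\<^esub> word_class R v = word_class R (u @ v)"
proof -
  have eq: "word_class R (u' @ v') = word_class R (u @ v)"
    if "u' \<in> word_class R u" "v' \<in> word_class R v" for u' v'
  proof -
    have "word_eq R u u'" "word_eq R v v'"
      using that by (simp_all add: word_class_def word_rel_def)
    then show ?thesis
      unfolding word_class_eq_iff by (intro word_eq.sym[OF word_eq_append])
  qed
  have mem: "u \<in> word_class R u" "v \<in> word_class R v"
    by (simp_all add: word_class_def word_rel_def word_eq.refl)
  have "(\<Union>u'\<in>word_class R u. \<Union>v'\<in>word_class R v. word_class R (u' @ v'))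
      = (\<Union>u'\<in>word_class R u. \<Union>v'\<in>word_class R v. word_class R (u @ v))"
    by (intro SUP_cong HOL.refl eq)
  also have "\<dots> = word_class R (u @ v)"
    using mem by auto
  finally show ?thesis
    by (simp add: presented_group_def)
qed

lemma presented_carrier: "carrier (presented_group R) = range (word_class R)"
  by (auto simp: presented_group_def word_class_def quotient_def)

lemma presented_one: "\<one>\<^bsub>presented_group R\<^esub> = word_class R []"
  by (simp add: presented_group_def)

definition word_inv :: "'g word \<Rightarrow> 'g word" where
  "word_inv u = rev (map (\<lambda>(g, b). (g, \<not> b)) u)"

lemma word_inv_left: "word_eq R (word_inv u @ u) []"
proof (induction u)
  case Nil
  show ?case by (simp add: word_inv_def word_eq.refl)
next
  case (Cons a u)
  obtain g b where a: "a = (g, b)" by (cases a)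
  have "word_eq R (word_inv u @ [(g, \<not> b), (g, \<not> \<not> b)] @ u) (word_inv u @ u)"
    by (rule word_eq.cancel)
  then show ?case
    using Cons by (auto simp: a word_inv_def intro: word_eq.trans)
qed

lemma group_presented_group: "group (presented_group R)"
proof (rule groupI)
  fix X assume "X \<in> carrier (presented_group R)"
  then obtain u where "X = word_class R u" by (auto simp: presented_carrier)
  then have "word_class R (word_inv u) \<otimes>\<^bsub>presented_group R\<^esub> X = \<one>\<^bsub>presented_group R\<^esub>"
    by (simp add: presented_mult presented_one word_class_eq_iff word_inv_left)
  then show "\<exists>Y\<in>carrier (presented_group R). Y \<otimes>\<^bsub>presented_group R\<^esub> X = \<one>\<^bsub>presented_group R\<^esub>"
    by (auto simp: presented_carrier)
qed (auto simp: presented_carrier presented_mult presented_one)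


section \<open>The braid group and the loop braid group on three strands\<close>

datatype braid_gen = Sig1 | Sig2

definition braid3_relations :: "(braid_gen word \<times> braid_gen word) set" where
  "braid3_relations =
     {([(Sig1, True), (Sig2, True), (Sig1, True)], [(Sig2, True), (Sig1, True), (Sig2, True)])}"

definition B3 :: "braid_gen word set monoid" where
  "B3 = presented_group braid3_relations"

definition B3_sigma1 :: "braid_gen word set" where
  "B3_sigma1 = presented_gen braid3_relations Sig1"

definition B3_sigma2 :: "braid_gen word set" where
  "B3_sigma2 = presented_gen braid3_relations Sig2"

datatype loop_gen = LSig1 | LSig2 | LS1 | LS2

definition loop_braid3_relations :: "(loop_gen word \<times> loop_gen word) set" where
  "loop_braid3_relations =
     {([(LSig1, True), (LSig2, True), (LSig1, True)], [(LSig2, True), (LSig1, True), (LSig2, True)]),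
      ([(LS1, True), (LS2, True), (LS1, True)], [(LS2, True), (LS1, True), (LS2, True)]),
      ([(LS1, True), (LS1, True)], []),
      ([(LS2, True), (LS2, True)], []),
      ([(LS1, True), (LS2, True), (LSig1, True)], [(LSig2, True), (LS1, True), (LS2, True)]),
      ([(LSig1, True), (LSig2, True), (LS1, True)], [(LS2, True), (LSig1, True), (LSig2, True)])}"

definition LB3 :: "loop_gen word set monoid" where
  "LB3 = presented_group loop_braid3_relations"

definition LB3_sigma1 :: "loop_gen word set" where
  "LB3_sigma1 = presented_gen loop_braid3_relations LSig1"

definition LB3_sigma2 :: "loop_gen word set" where
  "LB3_sigma2 = presented_gen loop_braid3_relations LSig2"


section \<open>Complex matrix representations\<close>

definition GL :: "(complex ^ 'n ^ 'n) monoid" where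
  "GL = units_of \<lparr>carrier = UNIV, mult = (**), one = mat 1\<rparr>"

definition representation :: "('a, 'b) monoid_scheme \<Rightarrow> ('a \<Rightarrow> complex ^ 'n ^ 'n) \<Rightarrow> bool" where
  "representation G \<rho> \<longleftrightarrow> \<rho> \<in> hom G GL"

text \<open>Here \<open>vec.subspace\<close> is the notion of a complex-linear subspace. The whole space is never zero,
  because index types are nonempty.\<close>

definition irreducible_representation ::
  "('a, 'b) monoid_scheme \<Rightarrow> ('a \<Rightarrow> complex ^ 'n ^ 'n) \<Rightarrow> bool" where
  "irreducible_representation G \<rho> \<longleftrightarrow>
     representation G \<rho> \<and>
     (\<forall>W :: (complex ^ 'n) set.
        vec.subspace W \<and> (\<forall>g\<in>carrier G. \<forall>w\<in>W. \<rho> g *v w \<in> W) \<longrightarrow> W = {0} \<or> W = UNIV)"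

definition extends_to_LB3 ::
  "(braid_gen word set \<Rightarrow> complex ^ 'n ^ 'n) \<Rightarrow> (loop_gen word set \<Rightarrow> complex ^ 'n ^ 'n) \<Rightarrow> bool" where
  "extends_to_LB3 \<rho> \<rho>' \<longleftrightarrow>
     representation LB3 \<rho>' \<and> \<rho>' LB3_sigma1 = \<rho> B3_sigma1 \<and> \<rho>' LB3_sigma2 = \<rho> B3_sigma2"


section \<open>The two matrices\<close>

definition \<omega> :: complex where
  "\<omega> = exp (2 * of_real pi * \<i> / 3)"

text \<open>The index type \<open>6\<close> consists of the residues modulo 6, so that \<open>6 = 0\<close>; \<open>vector\<close> fills the
  positions \<open>1, \<dots>, 6\<close> in this order.\<close>

lemma vector_6:
  "(vector [a, b, c, d, e, f] :: 'a::zero ^ 6) $ 1 = a"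
  "(vector [a, b, c, d, e, f] :: 'a::zero ^ 6) $ 2 = b"
  "(vector [a, b, c, d, e, f] :: 'a::zero ^ 6) $ 3 = c"
  "(vector [a, b, c, d, e, f] :: 'a::zero ^ 6) $ 4 = d"
  "(vector [a, b, c, d, e, f] :: 'a::zero ^ 6) $ 5 = e"
  "(vector [a, b, c, d, e, f] :: 'a::zero ^ 6) $ 6 = f"
  by (simp_all add: vector_def)

definition matA :: "complex ^ 6 ^ 6" where
  "matA = vector
    [vector [1, - \<omega> + 1, - \<omega>\<^sup>2 + 1, \<omega> - 1, \<omega>\<^sup>2 - 1, \<omega> - 1],
     vector [\<omega>\<^sup>2 - 1, \<omega>\<^sup>2, 0, - \<omega>\<^sup>2 + 1, 0, 0],
     vector [\<omega>\<^sup>2 - 1, \<omega>\<^sup>2 - 1, \<omega>\<^sup>2, - \<omega>\<^sup>2 + 1, - \<omega>\<^sup>2 + 1, 0],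
     vector [0, \<omega> - 1, \<omega>\<^sup>2 - 1, - \<omega>, - \<omega>\<^sup>2 + 1, - \<omega> + 1],
     vector [- \<omega>\<^sup>2 + 1, - \<omega>\<^sup>2 + 1, 0, \<omega>\<^sup>2 - 1, - 1, 0],
     vector [- \<omega>\<^sup>2 + 1, - \<omega>\<^sup>2 + 1, - \<omega>\<^sup>2 + 1, \<omega>\<^sup>2 - 1, \<omega>\<^sup>2 - 1, - 1]]"

definition matB :: "complex ^ 6 ^ 6" where
  "matB = vector
    [vector [1, - \<omega> + 1, - \<omega>\<^sup>2 + 1, - \<omega> + 1, - \<omega>\<^sup>2 + 1, - \<omega> + 1],
     vector [\<omega>\<^sup>2 - 1, \<omega>\<^sup>2, 0, \<omega>\<^sup>2 - 1, 0, 0],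
     vector [\<omega>\<^sup>2 - 1, \<omega>\<^sup>2 - 1, \<omega>\<^sup>2, \<omega>\<^sup>2 - 1, \<omega>\<^sup>2 - 1, 0],
     vector [0, - \<omega> + 1, - \<omega>\<^sup>2 + 1, - \<omega>, - \<omega>\<^sup>2 + 1, - \<omega> + 1],
     vector [\<omega>\<^sup>2 - 1, \<omega>\<^sup>2 - 1, 0, \<omega>\<^sup>2 - 1, - 1, 0],
     vector [\<omega>\<^sup>2 - 1, \<omega>\<^sup>2 - 1, \<omega>\<^sup>2 - 1, \<omega>\<^sup>2 - 1, \<omega>\<^sup>2 - 1, - 1]]"

end

theory Submission
  imports Defs
begin

text \<open>
  Write \<open>X = A B\<close> and \<open>J = A B A\<close>, so that \<open>J\<^sup>2 = X\<^sup>3 = 1\<close>. The group generated by \<open>A\<close> and \<open>B\<^sup>2\<close>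
  already acts irreducibly: \<open>A\<close> has the simple eigenvalue \<open>- \<omega>\<^sup>2\<close>, hence a polynomial in \<open>A\<close> has
  rank one, and both its image and its coimage generate the whole space.

  If \<open>s\<close>, \<open>t\<close> are the values of an extension at \<open>s\<^sub>1\<close>, \<open>s\<^sub>2\<close> and \<open>P = s t\<close>, then \<open>P\<close> and \<open>X\<close> both
  conjugate \<open>A\<close> into \<open>B\<close>, and \<open>P\<^sup>3 = (P X)\<^sup>3 = 1\<close> since \<open>P X = s X s\<close>. These relations force
  \<open>Z = X\<^sup>2 P\<close> to commute with \<open>A\<close> and with \<open>B\<^sup>2\<close>. Hence \<open>Z\<close> is a scalar \<open>c\<close>, \<open>P = c X\<close> and \<open>c\<^sup>3 = 1\<close>,
  while \<open>c X\<^sup>2 = s X s\<close> gives \<open>c tr(X\<^sup>2) = tr(X)\<close>. As \<open>tr(X) = 2 + \<omega>\<close> and \<open>tr(X\<^sup>2) = 1 - \<omega>\<close> have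
  different cubes, this is impossible.
\<close>

section \<open>Exact arithmetic with Eisenstein integers\<close>

lemma omega_eq: "\<omega> = - 1 / 2 + \<i> * of_real (sqrt 3) / 2"
proof -
  have "\<omega> = cis (2 * pi / 3)"
    unfolding \<omega>_def cis_conv_exp by (simp add: mult_ac)
  also have "\<dots> = - 1 / 2 + \<i> * of_real (sqrt 3) / 2"
    by (simp add: complex_eq_iff cos_120 sin_120)
  finally show ?thesis .
qed

lemma omega_square: "\<omega>\<^sup>2 = - 1 - \<omega>"
  by (simp add: omega_eq complex_eq_iff power2_eq_square field_simps)

lemma omega_mult: "\<omega> * \<omega> = - 1 - \<omega>"
  using omega_square by (simp add: power2_eq_square)

text \<open>\<open>(a, b)\<close> encodes a + b \<omega>. Both matrices have entries of this form,
  so their identities reduce to integer arithmetic that \<open>code_simp\<close> evaluates.\<close>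

type_synonym eisen = "int \<times> int"

definition eis :: "eisen \<Rightarrow> complex" where
  "eis p = of_int (fst p) + of_int (snd p) * \<omega>"

definition eadd :: "eisen \<Rightarrow> eisen \<Rightarrow> eisen" where
  "eadd p q = (fst p + fst q, snd p + snd q)"

definition emul :: "eisen \<Rightarrow> eisen \<Rightarrow> eisen" where
  "emul p q = (fst p * fst q - snd p * snd q, fst p * snd q + snd p * fst q - snd p * snd q)"

lemma eis_0: "eis (0, 0) = 0"
  and eis_1: "eis (1, 0) = 1"
  by (simp_all add: eis_def)

lemma eis_add: "eis (eadd p q) = eis p + eis q"
  by (simp add: eis_def eadd_def algebra_simps)

lemma eis_mul: "eis (emul p q) = eis p * eis q"
proof -
  have "eis p * eis q = of_int (fst p) * of_int (fst q)
      + (of_int (fst p) * of_int (snd q) + of_int (snd p) * of_int (fst q)) * \<omega>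
      + of_int (snd p) * of_int (snd q) * (\<omega> * \<omega>)"
    by (simp add: eis_def algebra_simps)
  then show ?thesis
    by (simp add: omega_mult) (simp add: eis_def emul_def algebra_simps)
qed

lemma eis_eq_0_iff: "eis p = 0 \<longleftrightarrow> p = (0, 0)"
  by (cases p) (auto simp: eis_def omega_eq complex_eq_iff)

lemma exhaust_6:
  fixes x :: 6
  shows "x = 1 \<or> x = 2 \<or> x = 3 \<or> x = 4 \<or> x = 5 \<or> x = 6"
proof (induct x)
  case (of_int z)
  then have "0 \<le> z" and "z < 6" by simp_all
  then have "z = 0 \<or> z = 1 \<or> z = 2 \<or> z = 3 \<or> z = 4 \<or> z = 5" by arith
  then show ?case by auto
qed

lemma forall_6: "(\<forall>i :: 6. P i) \<longleftrightarrow> P 1 \<and> P 2 \<and> P 3 \<and> P 4 \<and> P 5 \<and> P 6"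
  by (metis exhaust_6)

text \<open>The row of a matrix of type \<open>6\<close> that \<open>vector\<close> fills with the \<open>k\<close>-th list entry has index \<open>k + 1\<close>.\<close>

definition ix :: "6 \<Rightarrow> nat" where
  "ix i = (if i = 1 then 0 else if i = 2 then 1 else if i = 3 then 2
           else if i = 4 then 3 else if i = 5 then 4 else 5)"

lemma ix_simps: "ix 1 = 0" "ix 2 = 1" "ix 3 = 2" "ix 4 = 3" "ix 5 = 4" "ix 6 = 5"
  by (simp_all add: ix_def)

lemma bij_ix: "bij_betw ix UNIV {..<6}"
proof -
  have inj: "inj ix"
    by (simp add: inj_def forall_6 ix_simps)
  have "ix ` UNIV = {..<6}"
  proof (rule card_subset_eq)
    show "card (ix ` UNIV) = card {..<6::nat}"
      by (simp add: card_image[OF inj])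
  qed (auto simp: ix_def)
  with inj show ?thesis
    by (simp add: bij_betw_def)
qed

lemma ix_less: "ix i < 6"
  using bij_ix by (auto simp: bij_betw_def)

lemma ix_inj: "ix i = ix j \<longleftrightarrow> i = j"
  using bij_ix by (auto simp: bij_betw_def inj_def)

lemma sum_ix: "(\<Sum>i\<in>UNIV. f (ix i)) = sum f {..<6}"
  using sum.reindex_bij_betw[OF bij_ix] .

section \<open>Vectors and matrices over the Eisenstein integers as tables\<close>

definition evec :: "eisen list \<Rightarrow> complex ^ 6" where
  "evec x = (\<chi> i. eis (x ! ix i))"

definition emat :: "eisen list list \<Rightarrow> complex ^ 6 ^ 6" where
  "emat M = (\<chi> i j. eis (M ! ix i ! ix j))"

definition edot :: "(nat \<Rightarrow> eisen) \<Rightarrow> (nat \<Rightarrow> eisen) \<Rightarrow> eisen" where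
  "edot f g = foldr (\<lambda>k. eadd (emul (f k) (g k))) [0..<6] (0, 0)"

definition eapply :: "eisen list list \<Rightarrow> eisen list \<Rightarrow> eisen list" where
  "eapply M x = map (\<lambda>i. edot (\<lambda>k. M ! i ! k) (\<lambda>k. x ! k)) [0..<6]"

definition eapply_left :: "eisen list \<Rightarrow> eisen list list \<Rightarrow> eisen list" where
  "eapply_left x M = map (\<lambda>j. edot (\<lambda>k. x ! k) (\<lambda>k. M ! k ! j)) [0..<6]"

definition emat_of_fun :: "(nat \<Rightarrow> nat \<Rightarrow> eisen) \<Rightarrow> eisen list list" where
  "emat_of_fun f = map (\<lambda>i. map (f i) [0..<6]) [0..<6]"

definition ematmul :: "eisen list list \<Rightarrow> eisen list list \<Rightarrow> eisen list list" where
  "ematmul M N = emat_of_fun (\<lambda>i j. edot (\<lambda>k. M ! i ! k) (\<lambda>k. N ! k ! j))"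

definition etranspose :: "eisen list list \<Rightarrow> eisen list list" where
  "etranspose M = emat_of_fun (\<lambda>i j. M ! j ! i)"

definition escalar :: "eisen \<Rightarrow> eisen list list" where
  "escalar c = emat_of_fun (\<lambda>i j. if i = j then c else (0, 0))"

definition eouter :: "eisen \<Rightarrow> eisen list \<Rightarrow> eisen list \<Rightarrow> eisen list list" where
  "eouter c x y = emat_of_fun (\<lambda>i j. emul c (emul (x ! i) (y ! j)))"

definition eplus :: "eisen list list \<Rightarrow> eisen list list \<Rightarrow> eisen list list" where
  "eplus M N = emat_of_fun (\<lambda>i j. eadd (M ! i ! j) (N ! i ! j))"

text \<open>The leading coefficient \<open>1\<close> is left out of the list.\<close>

primrec emonic :: "eisen list list \<Rightarrow> eisen list \<Rightarrow> eisen list list" where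
  "emonic M [] = escalar (1, 0)"
| "emonic M (c # cs) = eplus (ematmul M (emonic M cs)) (escalar c)"

definition lin_form :: "eisen list \<Rightarrow> complex ^ 6 \<Rightarrow> complex" where
  "lin_form y v = (\<Sum>j\<in>UNIV. eis (y ! ix j) * v $ j)"

lemma eis_edot: "eis (edot f g) = (\<Sum>k\<in>UNIV. eis (f (ix k)) * eis (g (ix k)))"
proof -
  have "eis (foldr (\<lambda>k. eadd (emul (f k) (g k))) ks (0, 0))
      = (\<Sum>k\<leftarrow>ks. eis (f k) * eis (g k))" for ks
    by (induction ks) (simp_all add: eis_0 eis_add eis_mul)
  then have "eis (edot f g) = (\<Sum>k<6. eis (f k) * eis (g k))"
    by (simp add: edot_def sum_list_distinct_conv_sum_set atLeast0LessThan)
  then show ?thesis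
    by (simp add: sum_ix[of "\<lambda>k. eis (f k) * eis (g k)"])
qed

lemma emat_of_fun_nth: "emat_of_fun f ! ix i ! ix j = f (ix i) (ix j)"
  by (simp add: emat_of_fun_def ix_less)

lemma emat_of_fun: "emat (emat_of_fun f) = (\<chi> i j. eis (f (ix i) (ix j)))"
  by (simp add: emat_def emat_of_fun_nth)

lemma emat_mult: "emat M ** emat N = emat (ematmul M N)"
  by (simp add: ematmul_def emat_of_fun eis_edot) (simp add: emat_def matrix_matrix_mult_def)

lemma emat_apply: "emat M *v evec x = evec (eapply M x)"
  by (simp add: vec_eq_iff emat_def evec_def matrix_vector_mult_def eapply_def ix_less eis_edot)

lemma emat_escalar: "emat (escalar c) = mat (eis c)"
  by (simp add: escalar_def emat_of_fun mat_def vec_eq_iff ix_inj eis_0)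

lemma emat_transpose: "emat (etranspose M) = transpose (emat M)"
  by (simp add: etranspose_def emat_of_fun) (simp add: emat_def transpose_def)

lemma emat_plus: "emat (eplus M N) = emat M + emat N"
  by (simp add: eplus_def emat_of_fun eis_add) (simp add: emat_def vec_eq_iff)

lemma emat_outer: "emat (eouter c x y) *v v = (eis c * lin_form y v) *s evec x"
  by (simp add: eouter_def emat_of_fun vec_eq_iff matrix_vector_mult_def evec_def lin_form_def
      eis_mul sum_distrib_left sum_distrib_right mult_ac)

lemma emat_apply_nth: "(emat M *v v) $ i = lin_form (M ! ix i) v"
  by (simp add: emat_def matrix_vector_mult_def lin_form_def)

text \<open>Moving the matrix onto the coefficient list makes the functionals that vanish on an
  invariant subspace closed under \<open>eapply_left\<close>.\<close>

lemma lin_form_emat: "lin_form y (emat M *v v) = lin_form (eapply_left y M) v"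
proof -
  have "lin_form y (emat M *v v)
      = (\<Sum>i\<in>UNIV. \<Sum>j\<in>UNIV. eis (y ! ix i) * eis (M ! ix i ! ix j) * v $ j)"
    by (simp add: lin_form_def emat_def matrix_vector_mult_def sum_distrib_left mult_ac)
  also have "\<dots> = (\<Sum>j\<in>UNIV. \<Sum>i\<in>UNIV. eis (y ! ix i) * eis (M ! ix i ! ix j) * v $ j)"
    by (rule sum.swap)
  also have "\<dots> = lin_form (eapply_left y M) v"
    by (simp add: lin_form_def eapply_left_def ix_less eis_edot sum_distrib_right)
  finally show ?thesis .
qed

lemma mat_scale_vec: "mat c *v v = c *s (v :: complex ^ 'n)"
  by (simp add: vec_eq_iff matrix_vector_mult_def mat_def if_distrib if_distribR cong: if_cong)

lemma emonic_Nil: "emat (emonic M []) *v v = v"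
  by (simp add: emat_escalar eis_1)

text \<open>Horner's scheme, with the coefficients listed by increasing degree.\<close>

lemma emonic_Cons: "emat (emonic M (c # cs)) *v v = emat M *v (emat (emonic M cs) *v v) + eis c *s v"
  by (simp add: emat_plus emat_escalar matrix_vector_mult_add_rdistrib matrix_vector_mul_assoc
      mat_scale_vec flip: emat_mult)

section \<open>Irreducibility under the first generator and the square of the second\<close>

definition eA :: "eisen list list" where
  "eA =
    [[(1, 0), (1, -1), (2, 1), (-1, 1), (-2, -1), (-1, 1)],
     [(-2, -1), (-1, -1), (0, 0), (2, 1), (0, 0), (0, 0)],
     [(-2, -1), (-2, -1), (-1, -1), (2, 1), (2, 1), (0, 0)],
     [(0, 0), (-1, 1), (-2, -1), (0, -1), (2, 1), (1, -1)],
     [(2, 1), (2, 1), (0, 0), (-2, -1), (-1, 0), (0, 0)],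
     [(2, 1), (2, 1), (2, 1), (-2, -1), (-2, -1), (-1, 0)]]"

definition eB :: "eisen list list" where
  "eB =
    [[(1, 0), (1, -1), (2, 1), (1, -1), (2, 1), (1, -1)],
     [(-2, -1), (-1, -1), (0, 0), (-2, -1), (0, 0), (0, 0)],
     [(-2, -1), (-2, -1), (-1, -1), (-2, -1), (-2, -1), (0, 0)],
     [(0, 0), (1, -1), (2, 1), (0, -1), (2, 1), (1, -1)],
     [(-2, -1), (-2, -1), (0, 0), (-2, -1), (-1, 0), (0, 0)],
     [(-2, -1), (-2, -1), (-2, -1), (-2, -1), (-2, -1), (-1, 0)]]"

text \<open>With \<open>C = B\<^sup>2\<close>, the rows of \<open>orbit\<close> are \<open>v\<close>, \<open>C v\<close>, \<open>A C v\<close>, \<open>C\<^sup>2 v\<close>, \<open>C A\<^sup>2 C v\<close> and \<open>C A C\<^sup>2 v\<close>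
  for an eigenvector \<open>v\<close> of \<open>A\<close> with eigenvalue \<open>- \<omega>\<^sup>2\<close>. The rows of \<open>dual_orbit\<close> arise in the same
  way from the left eigenvector and the right actions of \<open>A\<close> and \<open>C\<close>. The inverse tables carry the
  common denominator \<open>12960\<close>.\<close>

definition orbit :: "eisen list list" where
  "orbit =
    [[(-1, -2), (1, 2), (0, 0), (-1, 0), (1, 0), (0, 0)],
     [(20, 13), (-8, -19), (-12, -24), (12, 5), (-12, -23), (-12, -24)],
     [(13, 20), (-19, -8), (-24, -12), (-5, -12), (23, 12), (24, 12)],
     [(-511, -275), (-83, 413), (132, 552), (-425, -5), (11, 455), (228, 456)],
     [(-247, -290), (439, 398), (360, 468), (23, -204), (481, 492), (264, 564)],
     [(-29, -103), (-31, 7), (36, 72), (-61, -121), (-11, 49), (60, 120)]]"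

definition orbit_inv :: "eisen list list" where
  "orbit_inv =
    [[(-9576, -3816), (-18120, -14856), (9744, 6384), (9576, 6312), (9000, 12360), (-6384, -3888)],
     [(7920, 17784), (1536, 18120), (-5520, -8016), (-1536, -17784), (5520, -4680), (6384, 2496)],
     [(-468, -441), (-462, -633), (57, 324), (460, 479), (70, 275), (20, -146)],
     [(153, 477), (-39, 483), (-132, -243), (1, -475), (205, -85), (146, 70)],
     [(252, 459), (138, 507), (-183, -216), (-100, -461), (110, -185), (160, 74)],
     [(-27, -423), (21, -537), (168, 297), (-19, 385), (-295, 175), (-74, -250)]]"

definition dual_orbit :: "eisen list list" where
  "dual_orbit =
    [[(-1, -2), (1, 2), (-1, -2), (1, 0), (-1, 0), (2, 0)],
     [(8, 19), (-8, 11), (-4, -5), (0, 19), (0, -1), (-12, -4)],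
     [(19, 8), (11, -8), (-5, -4), (-19, 0), (1, 0), (4, 12)],
     [(83, -413), (379, -277), (215, 139), (197, -451), (217, 1), (208, 4)],
     [(-439, -398), (-113, -178), (-79, 70), (-287, -360), (-217, 72), (194, 132)],
     [(31, -7), (-7, 31), (67, 65), (1, 1), (71, 71), (-10, 50)]]"

definition dual_orbit_inv :: "eisen list list" where
  "dual_orbit_inv =
    [[(-1200, 4656), (11904, 7680), (-63, -132), (324, 237), (297, 168), (-216, -183)],
     [(9576, 3816), (-7920, -17784), (468, 441), (-153, -477), (-252, -459), (27, 423)],
     [(19320, 10200), (-13440, -25800), (525, 765), (-285, -720), (-435, -675), (195, 720)],
     [(-2616, -8472), (-11904, 2184), (-90, -129), (-351, 15), (-270, 111), (369, 75)],
     [(-15960, -10200), (7920, 20280), (-440, -625), (145, 545), (260, 535), (-55, -635)],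
     [(-6960, 2160), (13440, 15600), (-370, -350), (350, 460), (370, 350), (-350, -460)]]"

text \<open>The characteristic polynomial of \<open>A\<close> divided by \<open>x + \<omega>\<^sup>2\<close>, without its leading coefficient.\<close>

definition quintic :: "eisen list" where
  "quintic = [(-1, 0), (0, 4), (-3, 20), (23, 20), (4, 4)]"

lemma matA_eq: "matA = emat eA"
  unfolding vec_eq_iff forall_6 matA_def emat_def eA_def
  by (simp add: vector_6 ix_simps eis_def omega_square)

lemma matB_eq: "matB = emat eB"
  unfolding vec_eq_iff forall_6 matB_def emat_def eB_def
  by (simp add: vector_6 ix_simps eis_def omega_square)

lemma matB_square: "matB ** matB = emat (ematmul eB eB)"
  by (simp add: matB_eq emat_mult)

lemma braid_relation: "matA ** matB ** matA = matB ** matA ** matB"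
proof -
  have "ematmul (ematmul eA eB) eA = ematmul (ematmul eB eA) eB"
    by code_simp
  then show ?thesis
    by (simp add: matA_eq matB_eq emat_mult)
qed

lemma half_twist_square: "(matA ** matB ** matA) ** (matA ** matB ** matA) = mat 1"
proof -
  have "ematmul (ematmul (ematmul eA eB) eA) (ematmul (ematmul eA eB) eA) = escalar (1, 0)"
    by code_simp
  then show ?thesis
    by (simp add: matA_eq matB_eq emat_mult emat_escalar eis_1)
qed

text \<open>The orbit vectors are the columns of the transpose, so a right inverse up to a nonzero
  factor shows that they span. For the dual table a left inverse is wanted: no nonzero vector is
  killed by all its rows.\<close>

lemma orbit_span: "transpose (emat orbit) ** emat orbit_inv = mat 12960"
proof -
  have "ematmul (etranspose orbit) orbit_inv = escalar (12960, 0)"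
    by code_simp
  then show ?thesis
    by (simp add: emat_mult emat_escalar flip: emat_transpose) (simp add: eis_def)
qed

lemma dual_orbit_span: "emat dual_orbit_inv ** emat dual_orbit = mat 12960"
proof -
  have "ematmul dual_orbit_inv dual_orbit = escalar (12960, 0)"
    by code_simp
  then show ?thesis
    by (simp add: emat_mult emat_escalar) (simp add: eis_def)
qed

text \<open>By Cayley-Hamilton this polynomial in \<open>A\<close> has its columns in the right and
  its rows in the left eigenspace for \<open>- \<omega>\<^sup>2\<close>. Both are lines, the
  eigenvalue being simple; \<open>(6, 6)\<close> adjusts the scale.\<close>

lemma quintic_matA:
  "emat (emonic eA quintic) *v v = (eis (6, 6) * lin_form (dual_orbit ! 0) v) *s evec (orbit ! 0)"
proof -
  have "emonic eA quintic = eouter (6, 6) (orbit ! 0) (dual_orbit ! 0)"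
    by code_simp
  then show ?thesis
    by (simp add: emat_outer)
qed

lemma subspace_emonic:
  assumes W: "vec.subspace W" and M: "\<And>w. w \<in> W \<Longrightarrow> emat M *v w \<in> W" and w: "w \<in> W"
  shows "emat (emonic M cs) *v w \<in> W"
  by (induction cs)
    (auto simp: emonic_Nil emonic_Cons w simp del: emonic.simps intro!: vec.subspace_add vec.subspace_scale W M)

text \<open>The \<open>foldr\<close> is Horner's scheme for the value of the polynomial at
  \<open>m\<close>.\<close>

lemma emonic_eigenvector:
  assumes "emat M *v v = eis m *s v"
  shows "emat (emonic M cs) *v v = eis (foldr (\<lambda>c x. eadd (emul m x) c) cs (1, 0)) *s v"
proof (induction cs)
  case Nil
  show ?case by (simp add: emonic_Nil eis_1 del: emonic.simps)
next
  case (Cons c cs)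
  then show ?case
    by (simp add: emonic_Cons assms vec.scale eis_add eis_mul vector_sadd_rdistrib mult_ac
        del: emonic.simps)
qed

lemma subspace_of_orbit:
  assumes W: "vec.subspace W"
    and A: "\<And>w. w \<in> W \<Longrightarrow> matA *v w \<in> W" and B: "\<And>w. w \<in> W \<Longrightarrow> matB ** matB *v w \<in> W"
    and start: "evec (orbit ! 0) \<in> W"
  shows "W = UNIV"
proof -
  let ?C = "ematmul eB eB"
  have A': "evec (eapply eA x) \<in> W" if "evec x \<in> W" for x
    using A[OF that] by (simp add: matA_eq emat_apply)
  have C': "evec (eapply ?C x) \<in> W" if "evec x \<in> W" for x
    using B[OF that] by (simp add: matB_square emat_apply)
  have eqs: "orbit ! 1 = eapply ?C (orbit ! 0)" "orbit ! 2 = eapply eA (orbit ! 1)"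
    "orbit ! 3 = eapply ?C (orbit ! 1)" "orbit ! 4 = eapply ?C (eapply eA (orbit ! 2))"
    "orbit ! 5 = eapply ?C (eapply eA (orbit ! 3))"
    by code_simp+
  have "evec (orbit ! 1) \<in> W" "evec (orbit ! 2) \<in> W" "evec (orbit ! 3) \<in> W"
      "evec (orbit ! 4) \<in> W" "evec (orbit ! 5) \<in> W"
    by (simp_all only: eqs A' C' start)
  then have mem: "\<forall>i. evec (orbit ! ix i) \<in> W"
    using start by (simp add: forall_6 ix_simps)
  have "y \<in> W" for y
  proof -
    \<comment> \<open>The coefficients of \<open>12960 *s y\<close> with respect to the orbit
      vectors.\<close>
    let ?c = "emat orbit_inv *v y"
    have "12960 *s y = transpose (emat orbit) *v ?c"
      by (simp add: matrix_vector_mul_assoc orbit_span mat_scale_vec)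
    also have "\<dots> = (\<Sum>i\<in>UNIV. ?c $ i *s evec (orbit ! ix i))"
      by (simp add: matrix_mult_sum column_transpose)
        (simp add: row_def emat_def evec_def)
    also have "\<dots> \<in> W"
      using mem by (intro vec.subspace_sum vec.subspace_scale W) auto
    finally have "(1 / 12960) *s (12960 *s y) \<in> W"
      by (rule vec.subspace_scale[OF W])
    then show ?thesis by simp
  qed
  then show ?thesis by auto
qed

text \<open>Norton's criterion. If the left eigenvector kills \<open>W\<close>, so does its whole
  orbit, and \<open>W\<close> is zero. Otherwise the rank one polynomial maps some vector of
  \<open>W\<close> to a nonzero multiple of the right eigenvector, whose orbit spans.\<close>

lemma invariant_subspace:
  assumes W: "vec.subspace W"
    and A: "\<And>w. w \<in> W \<Longrightarrow> matA *v w \<in> W" and B: "\<And>w. w \<in> W \<Longrightarrow> matB ** matB *v w \<in> W"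
  shows "W = {0} \<or> W = UNIV"
proof (cases "\<forall>w\<in>W. lin_form (dual_orbit ! 0) w = 0")
  case True
  let ?C = "ematmul eB eB"
  define ann where "ann y \<longleftrightarrow> (\<forall>w\<in>W. lin_form y w = 0)" for y
  have A': "ann (eapply_left y eA)" if "ann y" for y
    using that A by (auto simp: ann_def matA_eq simp flip: lin_form_emat)
  have C': "ann (eapply_left y ?C)" if "ann y" for y
    using that B by (auto simp: ann_def matB_square simp flip: lin_form_emat)
  have start: "ann (dual_orbit ! 0)"
    using True by (simp add: ann_def)
  have eqs: "dual_orbit ! 1 = eapply_left (dual_orbit ! 0) ?C"
    "dual_orbit ! 2 = eapply_left (dual_orbit ! 1) eA"
    "dual_orbit ! 3 = eapply_left (dual_orbit ! 1) ?C"
    "dual_orbit ! 4 = eapply_left (eapply_left (dual_orbit ! 2) eA) ?C"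
    "dual_orbit ! 5 = eapply_left (eapply_left (dual_orbit ! 3) eA) ?C"
    by code_simp+
  have "ann (dual_orbit ! 1)" "ann (dual_orbit ! 2)" "ann (dual_orbit ! 3)"
      "ann (dual_orbit ! 4)" "ann (dual_orbit ! 5)"
    by (simp_all only: eqs A' C' start)
  then have ann: "\<forall>i. ann (dual_orbit ! ix i)"
    using start by (simp add: forall_6 ix_simps)
  have "w = 0" if "w \<in> W" for w
  proof -
    have "emat dual_orbit *v w = 0"
      using ann that by (simp add: vec_eq_iff emat_apply_nth ann_def)
    then have "12960 *s w = 0"
      by (metis dual_orbit_span mat_scale_vec matrix_vector_mul_assoc matrix_vector_mult_0_right)
    then show ?thesis by simp
  qed
  then show ?thesis
    using vec.subspace_0[OF W] by auto
next
  case False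
  then obtain w where w: "w \<in> W" and ne: "lin_form (dual_orbit ! 0) w \<noteq> 0"
    by auto
  let ?k = "eis (6, 6) * lin_form (dual_orbit ! 0) w"
  have k: "?k \<noteq> 0"
    using ne by (simp add: eis_eq_0_iff)
  have "emat (emonic eA quintic) *v w \<in> W"
    using A w by (intro subspace_emonic W) (simp_all add: matA_eq)
  then have "?k *s evec (orbit ! 0) \<in> W"
    by (simp only: quintic_matA)
  then have "inverse ?k *s (?k *s evec (orbit ! 0)) \<in> W"
    by (rule vec.subspace_scale[OF W])
  then have "evec (orbit ! 0) \<in> W"
    using k by (simp add: field_simps)
  then show ?thesis
    using subspace_of_orbit[OF W A B] by blast
qed

text \<open>An explicit Schur lemma: \<open>Z\<close> preserves the eigenline of \<open>A\<close>,
  so it has an eigenvector there, and the corresponding eigenspace of \<open>Z\<close> is invariant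
  and contains the orbit of that vector.\<close>

lemma commutant_scalar:
  assumes A: "matA ** Z = Z ** matA" and B: "matB ** matB ** Z = Z ** (matB ** matB)"
  obtains c where "Z = mat c"
proof -
  let ?a = "evec (orbit ! 0)"
  have "eapply eA (orbit ! 0) = map (emul (1, 1)) (orbit ! 0)" and "length (orbit ! 0) = 6"
    by code_simp+
  then have a: "matA *v ?a = eis (1, 1) *s ?a"
    by (simp add: matA_eq emat_apply) (simp add: evec_def vec_eq_iff eis_mul ix_less)
  have "matA *v (Z *v ?a) = Z *v (matA *v ?a)"
    by (simp add: matrix_vector_mul_assoc A)
  also have "\<dots> = eis (1, 1) *s (Z *v ?a)"
    by (simp add: a vec.scale)
  finally have Za: "emat eA *v (Z *v ?a) = eis (1, 1) *s (Z *v ?a)"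
    by (simp only: matA_eq)
  \<comment> \<open>The value of the quintic at the eigenvalue \<open>(1, 1)\<close>, that is
    \<open>- \<omega>\<^sup>2\<close>. As it is nonzero, \<open>Z *v ?a\<close> lies in the image of
    the quintic, the line of \<open>?a\<close>.\<close>
  have "foldr (\<lambda>c x. eadd (emul (1, 1) x) c) quintic (1, 0) = (-48, -48)"
    by code_simp
  with emonic_eigenvector[OF Za, of quintic]
  have "emat (emonic eA quintic) *v (Z *v ?a) = eis (-48, -48) *s (Z *v ?a)"
    by simp
  then obtain k where k: "eis (-48, -48) *s (Z *v ?a) = k *s ?a"
    by (metis quintic_matA)
  define c where "c = k / eis (-48, -48)"
  have ne: "eis (-48, -48) \<noteq> 0"
    by (simp add: eis_eq_0_iff)
  have "Z *v ?a = inverse (eis (-48, -48)) *s (eis (-48, -48) *s (Z *v ?a))"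
    using ne by simp
  then have Za: "Z *v ?a = c *s ?a"
    unfolding k by (simp add: c_def field_simps)
  define W where "W = {v. Z *v v = c *s v}"
  have "W = UNIV"
  proof (rule subspace_of_orbit)
    show "vec.subspace W"
      by (simp add: W_def vec.subspace_def matrix_vector_right_distrib vector_add_ldistrib
          vec.scale mult.commute)
    show "matA *v w \<in> W" if "w \<in> W" for w
      using that by (simp add: W_def) (metis A matrix_vector_mul_assoc vec.scale)
    show "matB ** matB *v w \<in> W" if "w \<in> W" for w
      using that by (simp add: W_def) (metis B matrix_vector_mul_assoc vec.scale)
    show "?a \<in> W"
      using Za by (simp add: W_def)
  qed
  then have "Z *v v = mat c *v v" for v
    by (auto simp: W_def mat_scale_vec)
  then have "Z = mat c"
    by (simp add: matrix_eq)
  then show thesis ..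
qed

section \<open>Homomorphisms out of presented groups\<close>

definition letter_value :: "('a, 'm) monoid_scheme \<Rightarrow> ('g \<Rightarrow> 'a) \<Rightarrow> 'g \<times> bool \<Rightarrow> 'a" where
  "letter_value G f a = (if snd a then f (fst a) else inv\<^bsub>G\<^esub> f (fst a))"

primrec word_value :: "('a, 'm) monoid_scheme \<Rightarrow> ('g \<Rightarrow> 'a) \<Rightarrow> 'g word \<Rightarrow> 'a" where
  "word_value G f [] = \<one>\<^bsub>G\<^esub>"
| "word_value G f (a # u) = letter_value G f a \<otimes>\<^bsub>G\<^esub> word_value G f u"

context group
begin

lemma letter_value_closed: "range f \<subseteq> carrier G \<Longrightarrow> letter_value G f a \<in> carrier G"
  by (auto simp: letter_value_def)

lemma word_value_closed: "range f \<subseteq> carrier G \<Longrightarrow> word_value G f u \<in> carrier G"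
  by (induction u) (simp_all add: letter_value_closed)

lemma word_value_append:
  "range f \<subseteq> carrier G \<Longrightarrow> word_value G f (u @ v) = word_value G f u \<otimes> word_value G f v"
  by (induction u) (simp_all add: letter_value_closed word_value_closed m_assoc)

lemma word_value_eq:
  assumes f: "range f \<subseteq> carrier G"
    and R: "\<And>l r. (l, r) \<in> R \<Longrightarrow> word_value G f l = word_value G f r"
    and uv: "word_eq R u v"
  shows "word_value G f u = word_value G f v"
  using uv
proof (induction rule: word_eq.induct)
  case (cancel u g b v)
  have "f g \<in> carrier G"
    using f by auto
  then have "word_value G f [(g, b), (g, \<not> b)] = \<one>"
    by (simp add: letter_value_def)
  then show ?case
    using f by (simp only: word_value_append) (simp add: word_value_closed)
qed (simp_all add: word_value_append[OF f] R)

text \<open>The universal property of a presentation; it produces the representation from the two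
  matrices.\<close>

lemma presented_group_lift:
  assumes f: "range f \<subseteq> carrier G"
    and R: "\<And>l r. (l, r) \<in> R \<Longrightarrow> word_value G f l = word_value G f r"
  obtains h where "h \<in> hom (presented_group R) G" "\<And>g. h (presented_gen R g) = f g"
proof
  \<comment> \<open>The chosen representative is immaterial, because equivalent words have equal
    values.\<close>
  define h where "h X = word_value G f (SOME u. X = word_class R u)" for X
  have h: "h (word_class R u) = word_value G f u" for u
  proof -
    have "word_class R u = word_class R (SOME v. word_class R u = word_class R v)"
      by (rule someI) (rule HOL.refl)
    then show ?thesis
      unfolding h_def by (intro word_value_eq[OF f R, symmetric]) (simp_all add: word_class_eq_iff)
  qed
  show "h \<in> hom (presented_group R) G"
    by (rule homI)
      (auto simp: presented_carrier presented_mult h word_value_append word_value_closed f)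
  show "h (presented_gen R g) = f g" for g
    using f by (auto simp: presented_gen_def h letter_value_def image_subset_iff)
qed

end

section \<open>Matrix values of representations on positive words\<close>

lemma group_GL: "group (GL :: (complex ^ 'n ^ 'n) monoid)"
  unfolding GL_def
  by (intro monoid.units_group monoidI) (simp_all add: matrix_mul_assoc)

lemma GL_carrier: "M \<in> carrier GL \<longleftrightarrow> invertible M"
  by (auto simp: GL_def units_of_carrier Units_def invertible_def)

lemma GL_mult: "mult GL = (**)"
  by (simp add: GL_def units_of_mult)

lemma GL_one: "one GL = mat 1"
  by (simp add: GL_def units_of_one)

lemma representation_word:
  assumes "representation (presented_group R) \<rho>"
  shows "\<rho> (word_class R (map (\<lambda>g. (g, True)) gs)) = foldr (\<lambda>g M. \<rho> (presented_gen R g) ** M) gs (mat 1)"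
proof (induction gs)
  case Nil
  interpret group_hom "presented_group R" GL \<rho>
    using assms by (simp add: group_hom_def group_hom_axioms_def group_presented_group group_GL
        representation_def)
  show ?case
    using hom_one by (simp add: presented_one GL_one)
next
  case (Cons g gs)
  have "word_class R (map (\<lambda>g. (g, True)) (g # gs))
      = presented_gen R g \<otimes>\<^bsub>presented_group R\<^esub> word_class R (map (\<lambda>g. (g, True)) gs)"
    by (simp add: presented_gen_def presented_mult)
  then have "\<rho> (word_class R (map (\<lambda>g. (g, True)) (g # gs)))
      = \<rho> (presented_gen R g) ** \<rho> (word_class R (map (\<lambda>g. (g, True)) gs))"
    using assms
    by (simp add: representation_def hom_mult presented_carrier presented_gen_def GL_mult)
  with Cons show ?case by simp
qed

text \<open>The relations of \<open>LB3\<close> equate positive words, so each becomes a matrix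
  identity free of inverses.\<close>

lemma representation_relation:
  assumes "representation (presented_group R) \<rho>"
    and "(map (\<lambda>g. (g, True)) gs, map (\<lambda>g. (g, True)) hs) \<in> R"
  shows "foldr (\<lambda>g M. \<rho> (presented_gen R g) ** M) gs (mat 1)
    = foldr (\<lambda>g M. \<rho> (presented_gen R g) ** M) hs (mat 1)"
proof -
  have "word_eq R (map (\<lambda>g. (g, True)) gs) (map (\<lambda>g. (g, True)) hs)"
    using word_eq.relation[OF assms(2), of "[]" "[]"] by simp
  then show ?thesis
    using representation_word[OF assms(1)] by (metis word_class_eq_iff)
qed

section \<open>The obstruction to extending\<close>

text \<open>With products nested to the right, a rewrite rule must also match at the head of a
  longer product.\<close>

lemma matrix_mul_extend: "P ** Q = R \<Longrightarrow> P ** (Q ** M) = R ** (M :: complex ^ 'n ^ 'n)"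
  by (simp add: matrix_mul_assoc)

text \<open>\<open>Z\<close> is the inverse of X times P, and both X and P conjugate
  \<open>a\<close> into \<open>b\<close>, so \<open>Z\<close> commutes with \<open>a\<close>. For
  \<open>b ** b\<close> everything is written in J, \<open>a\<close>, \<open>Z\<close> and inverses;
  the two cube relations then yield two values of Z J Z, whose comparison is the claim.\<close>

lemma loop_commutation:
  fixes a b s t :: "complex ^ 'n ^ 'n"
  assumes braid: "a ** b ** a = b ** a ** b"
    and J2: "(a ** b ** a) ** (a ** b ** a) = mat 1"
    and s2: "s ** s = mat 1" and t2: "t ** t = mat 1" and sym: "s ** t ** s = t ** s ** t"
    and sta: "s ** t ** a = b ** s ** t" and abs: "a ** b ** s = t ** a ** b"
  defines "Z \<equiv> a ** b ** (a ** b) ** (s ** t)"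
  shows "a ** Z = Z ** a" and "b ** b ** Z = Z ** (b ** b)"
    and "a ** b ** Z = s ** t" and "(s ** t) ** (s ** t) ** (s ** t) = mat 1"
proof -
  note assoc = matrix_mul_assoc[symmetric]
  define J where "J = a ** b ** a"
  define X where "X = a ** b"
  define P where "P = s ** t"
  \<comment> \<open>\<open>N\<close> and \<open>a'\<close> will turn out to be the inverses of
    \<open>Z\<close> and \<open>a\<close>.\<close>
  define N where "N = t ** s ** X"
  define a' where "a' = J ** X"
  have JJ: "J ** J = mat 1"
    using J2 by (simp add: J_def)
  have J: "J = X ** a" "J = b ** X"
    using braid by (simp_all add: J_def X_def assoc)
  have "X ** (X ** X) = J ** (b ** a ** b)"
    by (simp add: X_def J_def assoc)
  then have X3: "X ** (X ** X) = mat 1"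
    using JJ by (simp add: J_def braid)
  have a'a: "a' ** a = mat 1"
    using JJ by (simp add: a'_def assoc flip: J(1))
  then have aa': "a ** a' = mat 1"
    by (simp add: matrix_left_right_inverse)
  have Z: "Z = X ** (X ** P)"
    by (simp add: Z_def X_def P_def assoc)
  have XZ: "X ** Z = P"
    using X3 by (simp add: Z matrix_mul_assoc)
  note cancel = s2 t2 JJ a'a aa' matrix_mul_extend[OF s2] matrix_mul_extend[OF t2]
    matrix_mul_extend[OF JJ] matrix_mul_extend[OF a'a] matrix_mul_extend[OF aa']
  have X3_cancel: "X ** (X ** (X ** M)) = M" for M
    using arg_cong[OF X3, of "\<lambda>Q. Q ** M"] by (simp add: assoc)
  have "P ** (P ** P) = (s ** t ** s) ** (t ** s ** t)"
    by (simp add: P_def assoc)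
  also have "\<dots> = (s ** t ** s) ** (s ** t ** s)"
    by (simp only: sym)
  also have "\<dots> = mat 1"
    by (simp add: assoc cancel)
  finally have P3: "P ** (P ** P) = mat 1" .
  have "t ** X = X ** s"
    using abs by (simp add: X_def assoc)
  \<comment> \<open>\<open>P X = s X s\<close> is a conjugate of \<open>X\<close> by an involution,
    so its cube is the identity as well.\<close>
  then have PX: "P ** X = s ** (X ** s)"
    by (simp add: P_def assoc)
  have PX3: "P ** (X ** (P ** (X ** (P ** X)))) = mat 1"
    by (simp add: PX matrix_mul_extend[OF PX] assoc cancel X3_cancel)

  have Pa: "P ** a = b ** P"
    using sta by (simp add: P_def assoc)
  have bX: "b ** X = X ** a"
    using J by simp
  \<comment> \<open>\<open>X ** X\<close> is the inverse of \<open>X\<close>, so this inverts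
    \<open>b X = X a\<close>; \<open>X^3 = 1\<close> is inserted to let \<open>b\<close> pass three
    factors \<open>X\<close>.\<close>
  have "X ** (X ** b) = X ** (X ** (b ** (X ** (X ** X))))"
    by (simp add: X3)
  also have "\<dots> = a ** (X ** X)"
    by (simp add: matrix_mul_extend[OF bX] assoc X3_cancel)
  finally have XXb: "X ** (X ** b) = a ** (X ** X)" .
  have aZ: "a ** Z = Z ** a"
    using arg_cong[OF XXb, of "\<lambda>Q. Q ** P"] by (simp add: Z assoc Pa)

  have PN: "P ** N = X"
    by (simp add: P_def N_def assoc cancel)
  have ZN: "Z ** N = mat 1"
    by (simp add: Z assoc PN X3)
  then have NZ: "N ** Z = mat 1"
    by (simp add: matrix_left_right_inverse)
  note cancelN = cancel ZN NZ matrix_mul_extend[OF ZN] matrix_mul_extend[OF NZ]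
  have a'Z: "a' ** Z = Z ** a'"
    using arg_cong[OF aZ, of "\<lambda>Q. a' ** (Q ** a')"] by (simp add: assoc cancelN)
  have a'N: "a' ** N = N ** a'"
    using arg_cong[OF a'Z, of "\<lambda>Q. N ** (Q ** N)"] by (simp add: assoc cancelN)

  have XJ: "X = J ** a'"
    by (simp add: J(1) assoc cancel)
  have "X ** X = X ** (X ** (X ** (a ** J)))"
    using JJ by (simp add: XJ assoc cancel)
  then have XX: "X ** X = a ** J"
    by (simp add: X3_cancel)
  have ts: "t ** s = N ** (X ** X)"
    by (simp add: N_def assoc X3)
  have Pts: "P ** (t ** s) = mat 1"
    by (simp add: P_def assoc cancel)

  text \<open>The two relations \<open>P^3 = 1\<close> and \<open>(P X)^3 = 1\<close> compute \<open>Z J Z\<close> in two ways.\<close>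
  have "P ** P = t ** s"
    using arg_cong[OF P3, of "\<lambda>Q. Q ** (t ** s)"] by (simp add: assoc Pts)
  \<comment> \<open>Both factors \<open>P\<close> become \<open>X Z = J a' Z\<close>, and
    \<open>t s\<close>, the inverse of \<open>P\<close>, becomes \<open>N a J\<close>.\<close>
  then have "J ** (a' ** (Z ** (J ** (a' ** Z)))) = N ** (a ** J)"
    by (simp add: XZ[symmetric] ts XX) (simp add: XJ assoc)
  from arg_cong[OF this, of "\<lambda>Q. a ** (J ** (Q ** a))"]
  have E1: "Z ** (J ** Z) = a ** (J ** (N ** (a ** (J ** a))))"
    by (simp add: assoc cancel a'Z)

  have "P ** (X ** (P ** X)) = X ** (X ** (N ** (X ** X)))"
  proof -
    \<comment> \<open>Padding with \<open>X^3 = 1\<close> and \<open>P t s = 1\<close> makes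
      \<open>(P X)^3\<close> appear.\<close>
    have "P ** (X ** (P ** X)) = P ** (X ** (P ** (X ** (P ** (X ** (X ** (X ** (t ** s))))))))"
      by (simp add: X3_cancel Pts)
    also have "\<dots> = (P ** (X ** (P ** (X ** (P ** X))))) ** (X ** (X ** (t ** s)))"
      by (simp only: assoc)
    finally show ?thesis
      by (simp add: PX3 ts)
  qed
  then have "X ** (Z ** (X ** (X ** (Z ** X)))) = X ** (X ** (N ** (X ** X)))"
    by (simp add: XZ[symmetric] assoc)
  from arg_cong[OF this, of "\<lambda>Q. X ** (X ** (Q ** (X ** X)))"]
  have "Z ** (X ** (X ** Z)) = X ** (N ** X)"
    by (simp add: assoc X3_cancel X3)
  then have "Z ** (a ** (J ** Z)) = J ** (a' ** (N ** (J ** a')))"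
    using XX by (simp add: matrix_mul_extend[OF XX] assoc) (simp add: XJ assoc)
  from arg_cong[OF this, of "\<lambda>Q. a' ** Q"]
  have E2: "Z ** (J ** Z) = a' ** (J ** (N ** (a' ** (J ** a'))))"
    by (simp add: matrix_mul_extend[OF aZ[symmetric]] matrix_mul_extend[OF a'N] assoc cancel)

  \<comment> \<open>\<open>X^3 = 1\<close> in terms of \<open>J\<close> and \<open>a'\<close> gives
    an exchange rule for \<open>a J a\<close>.\<close>
  have "X ** (X ** X) = J ** (a' ** (J ** (a' ** (J ** a'))))"
    by (simp add: XJ assoc)
  then have "J ** (a' ** (J ** (a' ** (J ** a')))) = mat 1"
    by (simp add: X3)
  from arg_cong[OF this, of "\<lambda>Q. a ** (J ** (Q ** a))"]
  have aJa: "a ** (J ** a) = J ** (a' ** J)"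
    by (simp add: assoc cancel)
  have aJa_extend: "a ** (J ** (a ** M)) = J ** (a' ** (J ** M))" for M
    using arg_cong[OF aJa, of "\<lambda>Q. Q ** M"] by (simp add: assoc)
  have "X ** (a ** J) = mat 1"
    by (simp add: matrix_mul_extend[OF J(1)[symmetric]] JJ)
  then have JaJ: "b = J ** (a ** J)"
    by (simp add: J(2) assoc)
  \<comment> \<open>\<open>b\<close> is the conjugate of \<open>a\<close> by the involution
    \<open>J\<close>; hence \<open>?q\<close> is its square and \<open>?q'\<close> the inverse of
    that.\<close>
  let ?q = "J ** (a ** (a ** J))" and ?q' = "J ** (a' ** (a' ** J))"
  have q: "b ** b = ?q"
    by (simp add: JaJ assoc cancel)
  from E1 E2 have "a ** (J ** (N ** (a ** (J ** a)))) = a' ** (J ** (N ** (a' ** (J ** a'))))"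
    by simp
  \<comment> \<open>These factors cancel everything but \<open>N\<close> on the right-hand side and
    leave \<open>N\<close> conjugated by \<open>?q\<close> on the left.\<close>
  from arg_cong[OF this, of "\<lambda>Q. J ** (a ** (Q ** (a ** (J ** a))))"]
  have "?q ** (N ** (a ** (J ** (a ** (a ** (J ** a)))))) = N"
    by (simp add: assoc cancel)
  moreover have "a ** (J ** (a ** (a ** (J ** a)))) = ?q'"
    by (simp add: aJa aJa_extend cancel)
  ultimately have "?q ** (N ** ?q') = N"
    by simp
  from arg_cong[OF this, of "\<lambda>Q. Z ** (Q ** (?q ** Z))"]
  show "b ** b ** Z = Z ** (b ** b)"
    by (simp add: q assoc cancelN)
  show "a ** Z = Z ** a" by fact
  show "a ** b ** Z = s ** t"
    using XZ by (simp add: X_def P_def)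
  show "(s ** t) ** (s ** t) ** (s ** t) = mat 1"
    using P3 by (simp add: P_def assoc)
qed

section \<open>The contradiction from traces\<close>

lemma trace_emat: "trace (emat M) = eis (edot (\<lambda>k. M ! k ! k) (\<lambda>k. (1, 0)))"
  by (simp add: trace_def emat_def eis_edot eis_1)

lemma mat_mult_left: "mat c ** M = (\<chi> i j. c * (M :: complex ^ 'n ^ 'n) $ i $ j)"
  by (simp add: vec_eq_iff matrix_matrix_mult_def mat_def if_distrib if_distribR cong: if_cong)

lemma mat_mult_right: "M ** mat c = mat c ** (M :: complex ^ 'n ^ 'n)"
  by (simp add: mat_mult_left) (simp add: vec_eq_iff matrix_matrix_mult_def mat_def if_distrib
      if_distribR mult.commute cong: if_cong)

lemma trace_mat_mult: "trace (mat c ** M) = c * trace (M :: complex ^ 'n ^ 'n)"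
  by (simp add: mat_mult_left trace_def sum_distrib_left)

lemma no_loop_braid_relations:
  assumes s2: "s ** s = mat 1" and t2: "t ** t = mat 1" and sym: "s ** t ** s = t ** s ** t"
    and sta: "s ** t ** matA = matB ** s ** t" and abs: "matA ** matB ** s = t ** matA ** matB"
  shows False
proof -
  note loop = loop_commutation[OF braid_relation half_twist_square s2 t2 sym sta abs]
  let ?X = "matA ** matB"
  obtain c where c: "?X ** ?X ** (s ** t) = mat c"
    using commutant_scalar[OF loop(1,2)] by blast
  have P: "s ** t = mat c ** ?X"
    using loop(3) by (simp add: c mat_mult_right)
  have X3: "?X ** ?X ** ?X = mat 1"
    using half_twist_square by (simp add: braid_relation) (simp add: matrix_mul_assoc braid_relation)
  have scal: "mat p ** M ** (mat q ** N) = mat (p * q) ** (M ** N)"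
    for p q and M N :: "complex ^ 6 ^ 6"
    unfolding mat_mult_left
    by (simp add: vec_eq_iff matrix_matrix_mult_def sum_distrib_left mult_ac)
  have "mat (c * c * c) ** (?X ** ?X ** ?X) = mat 1"
    using loop(4) by (simp only: P scal)
  then have "mat (c * c * c) = (mat 1 :: complex ^ 6 ^ 6)"
    by (simp add: X3)
  then have c3: "c * c * c = 1"
    by (simp add: vec_eq_iff mat_def) metis
  have "s ** t ** ?X = s ** (t ** matA ** matB)"
    by (simp add: matrix_mul_assoc)
  also have "\<dots> = s ** ?X ** s"
    by (simp add: abs[symmetric] matrix_mul_assoc)
  finally have "mat c ** (?X ** ?X) = s ** ?X ** s"
    by (simp add: P matrix_mul_assoc)
  then have "c * trace (?X ** ?X) = trace (s ** ?X ** s)"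
    by (metis trace_mat_mult)
  also have "\<dots> = trace (s ** (s ** ?X))"
    by (rule trace_mul_sym)
  also have "\<dots> = trace ?X"
    by (simp add: matrix_mul_assoc s2)
  finally have tr: "c * trace (?X ** ?X) = trace ?X" .
  have X: "?X = emat (ematmul eA eB)"
    by (simp add: matA_eq matB_eq emat_mult)
  have "edot (\<lambda>k. ematmul eA eB ! k ! k) (\<lambda>k. (1, 0)) = (2, 1)"
    "edot (\<lambda>k. ematmul (ematmul eA eB) (ematmul eA eB) ! k ! k) (\<lambda>k. (1, 0)) = (1, -1)"
    by code_simp+
  with tr have eq: "c * eis (1, -1) = eis (2, 1)"
    by (simp add: X emat_mult trace_emat)
  \<comment> \<open>Cubing removes \<open>c\<close>. The traces \<open>1 - \<omega>\<close> and
    \<open>2 + \<omega> = 1 - \<omega>\<^sup>2\<close> are complex conjugates with purely imaginary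
    nonzero cubes, which therefore differ in sign.\<close>
  have "c * c * c * (eis (1, -1) * eis (1, -1) * eis (1, -1))
      = (c * eis (1, -1)) * (c * eis (1, -1)) * (c * eis (1, -1))"
    by (simp add: mult_ac)
  then have "eis (emul (emul (1, -1) (1, -1)) (1, -1)) = eis (emul (emul (2, 1) (2, 1)) (2, 1))"
    by (simp add: c3 eq eis_mul)
  then show False
    by (simp add: emul_def eis_def omega_eq complex_eq_iff)
qed

lemma not_extends_to_LB3:
  assumes \<rho>: "\<rho> B3_sigma1 = matA" "\<rho> B3_sigma2 = matB"
  shows "\<not> extends_to_LB3 \<rho> \<rho>'"
proof
  assume ext: "extends_to_LB3 \<rho> \<rho>'"
  let ?R = loop_braid3_relations
  have rep: "representation (presented_group ?R) \<rho>'"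
    and A: "\<rho>' (presented_gen ?R LSig1) = matA" and B: "\<rho>' (presented_gen ?R LSig2) = matB"
    using ext \<rho> by (simp_all add: extends_to_LB3_def LB3_def LB3_sigma1_def LB3_sigma2_def)
  let ?s = "\<rho>' (presented_gen ?R LS1)" and ?t = "\<rho>' (presented_gen ?R LS2)"
  let ?F = "\<lambda>g M. \<rho>' (presented_gen ?R g) ** M"
  have "foldr ?F [LS1, LS1] (mat 1) = foldr ?F [] (mat 1)"
    "foldr ?F [LS2, LS2] (mat 1) = foldr ?F [] (mat 1)"
    "foldr ?F [LS1, LS2, LS1] (mat 1) = foldr ?F [LS2, LS1, LS2] (mat 1)"
    "foldr ?F [LS1, LS2, LSig1] (mat 1) = foldr ?F [LSig2, LS1, LS2] (mat 1)"
    "foldr ?F [LSig1, LSig2, LS1] (mat 1) = foldr ?F [LS2, LSig1, LSig2] (mat 1)"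
    by (rule representation_relation[OF rep], simp add: loop_braid3_relations_def)+
  then have "?s ** ?s = mat 1" "?t ** ?t = mat 1" "?s ** ?t ** ?s = ?t ** ?s ** ?t"
    "?s ** ?t ** matA = matB ** ?s ** ?t" "matA ** matB ** ?s = ?t ** matA ** matB"
    by (simp_all add: A B matrix_mul_assoc)
  then show False
    by (rule no_loop_braid_relations)
qed

section \<open>Existence and irreducibility of the braid group representation\<close>

lemma braid_representation_exists:
  obtains \<rho> where "representation B3 \<rho>" "\<rho> B3_sigma1 = matA" "\<rho> B3_sigma2 = matB"
proof -
  let ?f = "case_braid_gen matA matB"
  let ?J = "matA ** matB ** matA"
  \<comment> \<open>Splitting off the first factor of \<open>?J ** ?J = mat 1\<close>, read in
    either form of the braid relation, exhibits right inverses.\<close>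
  have "matA ** (matB ** matA ** ?J) = mat 1"
    using half_twist_square by (simp add: matrix_mul_assoc)
  moreover have "matB ** (matA ** matB ** ?J) = mat 1"
    using half_twist_square braid_relation by (simp add: matrix_mul_assoc)
  ultimately have "invertible matA" "invertible matB"
    by (auto simp: invertible_right_inverse)
  then have f: "range ?f \<subseteq> carrier GL"
    by (auto simp: GL_carrier split: braid_gen.split)
  have "word_value GL ?f l = word_value GL ?f r" if "(l, r) \<in> braid3_relations" for l r
    using that braid_relation
    by (simp add: braid3_relations_def letter_value_def GL_mult GL_one matrix_mul_assoc)
  then obtain h where "h \<in> hom (presented_group braid3_relations) GL"
    "\<And>g. h (presented_gen braid3_relations g) = ?f g"
    using group.presented_group_lift[OF group_GL f] by blast
  then show thesis
    by (intro that[of h]) (simp_all add: representation_def B3_def B3_sigma1_def B3_sigma2_def)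
qed

lemma braid_representation_irreducible:
  assumes rep: "representation B3 \<rho>" and \<rho>: "\<rho> B3_sigma1 = matA" "\<rho> B3_sigma2 = matB"
  shows "irreducible_representation B3 \<rho>"
  unfolding irreducible_representation_def
proof (intro conjI allI impI rep)
  fix W :: "(complex ^ 6) set"
  assume W: "vec.subspace W \<and> (\<forall>g\<in>carrier B3. \<forall>w\<in>W. \<rho> g *v w \<in> W)"
  have "B3_sigma1 \<in> carrier B3" "B3_sigma2 \<in> carrier B3"
    by (simp_all add: B3_def B3_sigma1_def B3_sigma2_def presented_gen_def presented_carrier)
  then have "matA *v w \<in> W" "matB *v w \<in> W" if "w \<in> W" for w
    using W that \<rho> by metis+
  then show "W = {0} \<or> W = UNIV"
    using W by (intro invariant_subspace) (simp_all flip: matrix_vector_mul_assoc)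
qed

theorem proposition6p1:
  shows "(\<exists>\<rho> :: braid_gen word set \<Rightarrow> complex ^ 6 ^ 6.
            representation B3 \<rho> \<and> \<rho> B3_sigma1 = matA \<and> \<rho> B3_sigma2 = matB) \<and>
         (\<forall>\<rho> :: braid_gen word set \<Rightarrow> complex ^ 6 ^ 6.
            representation B3 \<rho> \<and> \<rho> B3_sigma1 = matA \<and> \<rho> B3_sigma2 = matB \<longrightarrow>
              irreducible_representation B3 \<rho> \<and> \<not> (\<exists>\<rho>'. extends_to_LB3 \<rho> \<rho>'))"
proof (intro conjI allI impI notI; (elim conjE exE)?)
  show "\<exists>\<rho> :: braid_gen word set \<Rightarrow> complex ^ 6 ^ 6.
      representation B3 \<rho> \<and> \<rho> B3_sigma1 = matA \<and> \<rho> B3_sigma2 = matB"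
    using braid_representation_exists by metis
qed (simp_all add: braid_representation_irreducible not_extends_to_LB3)

end
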